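(* Let $X,Y$ be compact topometric spaces, let $\pi\colon X\to Y$ be a continuous surjective precise map, and assume that $X$ is homogeneous over $Y$ (via $\pi$). Then for all $K\subseteq Y$, $*\in\{f,b\}$ and $\varepsilon>0$, $$\mathrm{CB}^Y_{*,\varepsilon}(K)=\mathrm{CB}^X_{*,\varepsilon}(\pi^{-1}(K)).$$ Moreover, if this common rank is an ordinal (and $K$ is compact, so that the degrees are defined), then $$\mathrm{CBd}^Y_{*,\varepsilon}(K)=\mathrm{CBd}^X_{*,\varepsilon}(\pi^{-1}(K)).$$
   Context: A topometric space is a triple $(X,\mathscr{T},d)$ where $\mathscr{T}$ is a topology on $X$ and $d\colon X^2\to[0,\infty]$ is a metric (infinite distances allowed) such that (1) $d$ refines the topology: for every open $U$ and $x\in U$ there is $r>0$ with $\{y: d(x,y)<r\}\subseteq U$; (2) $d$ is lower semi-continuous: for every real $r\ge 0$ the set $\{(a,b): d(a,b)\le r\}$ is closed in $X^2$. Topological terms refer to $\mathscr{T}$. By convention $d(x,\varnothing)=\infty$ and $d(x,A)=\inf_{a\in A}d(x,a)$. A map $\pi\colon X\to Y$ is precise if $d_Y(\pi(x),y)=d_X(x,\pi^{-1}(y))$ for all $x\in X,y\in Y$. $X$ is homogeneous over $Y$ (over $\pi$) if for every $K\subseteq U\subseteq Y$ with $K$ compact and $U$ open, and every countable $X_0\subseteq\pi^{-1}(K)$, there is an isometric automorphism $f$ of $X$ (a self-homeomorphism that is an isometry) such that $\pi\circ f|_{X_0}$ is isometric (distance-preserving) with image in $U$. A set $A$ is $\varepsilon$-$\alpha$-finite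 ($\alpha\le\omega$) if there is no family $(a_i)_{i\le\alpha}$ in $A$ with $d(a_i,a_j)>\varepsilon$ for all $i<j\le\alpha$; $\varepsilon$-finite if $\varepsilon$-$n$-finite for some $n<\omega$; $\varepsilon$-bounded if $\varepsilon$-$\omega$-finite. Let $X'_{f,\varepsilon}$ (resp. $X'_{b,\varepsilon}$) be $X$ minus the union of all its open $\varepsilon$-finite (resp. open $\varepsilon$-bounded) subsets. For $*\in\{f,b\}$: $X^{(0)}_{*,\varepsilon}=X$, $X^{(\alpha+1)}_{*,\varepsilon}=(X^{(\alpha)}_{*,\varepsilon})'_{*,\varepsilon}$ (computed in the subspace with induced structure), intersections at limits. For $A\subseteq X$, $\mathrm{CB}^X_{*,\varepsilon}(A)=\sup\{\alpha: X^{(\alpha)}_{*,\varepsilon}\cap A\neq\varnothing\}$ ($\infty$ if this holds for all $\alpha$). Degrees, for compact $K\subseteq X$ with $\mathrm{CB}^X_{*,\varepsilon}(K)=\alpha<\infty$: $\mathrm{CBd}^X_{f,\varepsilon}(K)$ is the least $n$ such that $X^{(\alpha)}_{f,\varepsilon}\cap K\subseteq U$ for some relatively open $\varepsilon$-$n$-finite $U\subseteq X^{(\alpha)}_{f,\varepsilon}$; $\mathrm{CBd}^X_{b,\varepsilon}(K)$ is the least $n$ such that $X^{(\alpha)}_{b,\varepsilon}\cap K\subseteq U$ for some relatively open $U\subseteq X^{(\alpha)}_{b,\varepsilon}$ which is $\varepsilon$-bounded and $2\varepsilon$-$n$-finite. *)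

theory Defs
  imports "HOL-Analysis.Analysis"
begin

section \<open>Ordinals\<close>

text \<open>
  HOL has no type of all ordinals. We use the well-order \<open>cardSuc (card_of (UNIV :: ('i + nat) set))\<close>,
  whose order type is the least cardinal greater than that of the infinite type \<open>'i + nat\<close>; its elements
  stand for the ordinals below that cardinal. Lemma \<open>CB_seq_stabilises\<close> below shows that no
  further ordinals are needed for spaces whose points inject into \<open>'i\<close>.
\<close>

typedef 'i ordinal = "Field (cardSuc (card_of (UNIV :: ('i + nat) set)))"
proof -
  have "Field (cardSuc (card_of (UNIV :: ('i + nat) set))) \<noteq> {}"
    by (rule Field_cardSuc_not_empty) (rule card_of_Card_order)
  then show ?thesis by blast
qed

lemma Well_order_ordinal: "Well_order (cardSuc (card_of (UNIV :: ('i + nat) set)))"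
  using cardSuc_Card_order card_of_Card_order card_order_on_def by blast

instantiation ordinal :: (type) wellorder
begin

definition less_eq_ordinal :: "'a ordinal \<Rightarrow> 'a ordinal \<Rightarrow> bool" where
  "\<alpha> \<le> \<beta> \<longleftrightarrow> (Rep_ordinal \<alpha>, Rep_ordinal \<beta>) \<in> cardSuc (card_of (UNIV :: ('a + nat) set))"

definition less_ordinal :: "'a ordinal \<Rightarrow> 'a ordinal \<Rightarrow> bool" where
  "(\<alpha> :: 'a ordinal) < \<beta> \<longleftrightarrow> \<alpha> \<le> \<beta> \<and> \<alpha> \<noteq> \<beta>"

instance
proof
  let ?r = "cardSuc (card_of (UNIV :: ('a + nat) set))"
  have wo: "Well_order ?r" by (rule Well_order_ordinal)
  then have refl: "Refl ?r" and trans: "trans ?r" and antisym: "antisym ?r" and total: "Total ?r"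
    and wf: "wf (?r - Id)"
    unfolding well_order_on_def linear_order_on_def partial_order_on_def preorder_on_def by auto
  fix x y z :: "'a ordinal"
  show "x \<le> x"
    using refl Rep_ordinal[of x] by (auto simp: less_eq_ordinal_def refl_on_def)
  show "x \<le> z" if "x \<le> y" "y \<le> z"
    using that trans unfolding less_eq_ordinal_def by (blast dest: transD)
  show a: "x = y" if "x \<le> y" "y \<le> x" for x y :: "'a ordinal"
    using that antisym unfolding less_eq_ordinal_def by (metis antisymD Rep_ordinal_inject)
  show "x < y \<longleftrightarrow> x \<le> y \<and> \<not> y \<le> x"
    using a \<open>x \<le> x\<close> by (auto simp: less_ordinal_def)
  show "x \<le> y \<or> y \<le> x"
    using total \<open>x \<le> x\<close> Rep_ordinal[of x] Rep_ordinal[of y]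
    by (cases "x = y") (auto simp: less_eq_ordinal_def total_on_def Rep_ordinal_inject)
  fix P :: "'a ordinal \<Rightarrow> bool" and a :: "'a ordinal"
  assume step: "\<And>x. (\<And>y. y < x \<Longrightarrow> P y) \<Longrightarrow> P x"
  have "wf (inv_image (?r - Id) Rep_ordinal)"
    using wf by (rule wf_inv_image)
  then show "P a"
  proof (induction a)
    case (less x)
    show ?case
      by (rule step, rule less)
        (auto simp: less_ordinal_def less_eq_ordinal_def inv_image_def Rep_ordinal_inject)
  qed
qed

end

lemma ordinal_no_max: "\<exists>\<beta>. (\<alpha> :: 'i ordinal) < \<beta>"
proof -
  let ?r = "cardSuc (card_of (UNIV :: ('i + nat) set))"
  have "Card_order ?r"
    by (rule cardSuc_Card_order) (rule card_of_Card_order)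
  moreover have "infinite (Field ?r)"
    by (simp add: card_of_cardSuc_finite)
  ultimately obtain b where "b \<in> Field ?r" "Rep_ordinal \<alpha> \<noteq> b" "(Rep_ordinal \<alpha>, b) \<in> ?r"
    using infinite_Card_order_limit[of ?r "Rep_ordinal \<alpha>"] Rep_ordinal[of \<alpha>] by auto
  then have "\<alpha> < Abs_ordinal b"
    by (auto simp: less_ordinal_def less_eq_ordinal_def Abs_ordinal_inverse)
  then show ?thesis ..
qed

lemma ordinal_not_inj: "\<not> inj (f :: 'i ordinal \<Rightarrow> 'i + nat)"
proof
  let ?r = "cardSuc (card_of (UNIV :: ('i + nat) set))"
  assume f: "inj f"
  have "inj_on (f \<circ> Abs_ordinal) (Field ?r)"
    by (intro comp_inj_on inj_onI) (use f in \<open>auto simp: Abs_ordinal_inject inj_on_def\<close>)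
  then have "(card_of (Field ?r), card_of (UNIV :: ('i + nat) set)) \<in> ordLeq"
    using card_of_ordLeq by blast
  moreover have "(card_of (UNIV :: ('i + nat) set), ?r) \<in> ordLess"
    by (rule cardSuc_greater) (rule card_of_Card_order)
  moreover have "(card_of (Field ?r), ?r) \<in> ordIso"
    using card_of_Field_ordIso cardSuc_Card_order card_of_Card_order by blast
  ultimately show False
    using not_ordLess_ordIso ordIso_ordLeq_trans ordIso_symmetric not_ordLess_ordLeq by blast
qed

definition osuc :: "'i ordinal \<Rightarrow> 'i ordinal" where
  "osuc \<alpha> = (LEAST \<beta>. \<alpha> < \<beta>)"

lemma less_osuc: "\<alpha> < osuc \<alpha>"
  unfolding osuc_def using ordinal_no_max by (rule LeastI_ex)

lemma osuc_le_iff: "osuc \<alpha> \<le> \<beta> \<longleftrightarrow> \<alpha> < \<beta>"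
  using less_osuc[of \<alpha>] Least_le[of "\<lambda>\<beta>. \<alpha> < \<beta>" \<beta>] unfolding osuc_def by auto

lemma osuc_inject: "osuc \<alpha> = osuc \<beta> \<longleftrightarrow> \<alpha> = \<beta>"
  by (metis less_osuc linorder_neqE not_less osuc_le_iff)

definition limit_ordinal :: "'i ordinal \<Rightarrow> bool" where
  "limit_ordinal \<delta> \<longleftrightarrow> (\<exists>\<beta>. \<beta> < \<delta>) \<and> (\<forall>\<beta>. \<delta> \<noteq> osuc \<beta>)"


section \<open>Topometric spaces\<close>

definition topometric_space :: "'a topology \<Rightarrow> ('a \<Rightarrow> 'a \<Rightarrow> ennreal) \<Rightarrow> bool" where
  "topometric_space X d \<longleftrightarrow>
     (\<forall>x\<in>topspace X. \<forall>y\<in>topspace X. d x y = 0 \<longleftrightarrow> x = y) \<and>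
     (\<forall>x\<in>topspace X. \<forall>y\<in>topspace X. d x y = d y x) \<and>
     (\<forall>x\<in>topspace X. \<forall>y\<in>topspace X. \<forall>z\<in>topspace X. d x z \<le> d x y + d y z) \<and>
     (\<forall>U x. openin X U \<longrightarrow> x \<in> U \<longrightarrow> (\<exists>r::real. r > 0 \<and> {y \<in> topspace X. d x y < ennreal r} \<subseteq> U)) \<and>
     (\<forall>r::real. r \<ge> 0 \<longrightarrow>
        closedin (prod_topology X X) {(a, b). a \<in> topspace X \<and> b \<in> topspace X \<and> d a b \<le> ennreal r})"

text \<open>The infimum over the empty set is \<open>\<infinity>\<close> in \<^typ>\<open>ennreal\<close>.\<close>

definition set_distance :: "('a \<Rightarrow> 'a \<Rightarrow> ennreal) \<Rightarrow> 'a \<Rightarrow> 'a set \<Rightarrow> ennreal" where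
  "set_distance d x A = (INF a\<in>A. d x a)"

definition preimage :: "'a topology \<Rightarrow> ('a \<Rightarrow> 'b) \<Rightarrow> 'b set \<Rightarrow> 'a set" where
  "preimage X p B = {x \<in> topspace X. p x \<in> B}"

definition precise_map ::
  "'a topology \<Rightarrow> ('a \<Rightarrow> 'a \<Rightarrow> ennreal) \<Rightarrow> 'b topology \<Rightarrow> ('b \<Rightarrow> 'b \<Rightarrow> ennreal) \<Rightarrow> ('a \<Rightarrow> 'b) \<Rightarrow> bool"
  where
  "precise_map X dX Y dY p \<longleftrightarrow>
     (\<forall>x\<in>topspace X. \<forall>y\<in>topspace Y. dY (p x) y = set_distance dX x (preimage X p {y}))"

definition isometric_automorphism :: "'a topology \<Rightarrow> ('a \<Rightarrow> 'a \<Rightarrow> ennreal) \<Rightarrow> ('a \<Rightarrow> 'a) \<Rightarrow> bool" where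
  "isometric_automorphism X d f \<longleftrightarrow>
     homeomorphic_map X X f \<and> (\<forall>x\<in>topspace X. \<forall>y\<in>topspace X. d (f x) (f y) = d x y)"

definition homogeneous_over ::
  "'a topology \<Rightarrow> ('a \<Rightarrow> 'a \<Rightarrow> ennreal) \<Rightarrow> 'b topology \<Rightarrow> ('b \<Rightarrow> 'b \<Rightarrow> ennreal) \<Rightarrow> ('a \<Rightarrow> 'b) \<Rightarrow> bool"
  where
  "homogeneous_over X dX Y dY p \<longleftrightarrow>
     (\<forall>K U X0. compactin Y K \<longrightarrow> openin Y U \<longrightarrow> K \<subseteq> U \<longrightarrow>
        countable X0 \<longrightarrow> X0 \<subseteq> preimage X p K \<longrightarrow>
        (\<exists>f. isometric_automorphism X dX f \<and>
             (\<forall>x\<in>X0. \<forall>y\<in>X0. dY (p (f x)) (p (f y)) = dX x y) \<and>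
             (\<forall>x\<in>X0. p (f x) \<in> U)))"


section \<open>Cantor--Bendixson ranks\<close>

text \<open>Taking \<^typ>\<open>enat\<close> as the index type covers the ordinals up to and including \<open>\<omega>\<close>.\<close>

definition eps_card_finite :: "('a \<Rightarrow> 'a \<Rightarrow> ennreal) \<Rightarrow> real \<Rightarrow> enat \<Rightarrow> 'a set \<Rightarrow> bool" where
  "eps_card_finite d \<epsilon> \<alpha> A \<longleftrightarrow>
     \<not> (\<exists>a :: enat \<Rightarrow> 'a. (\<forall>i\<le>\<alpha>. a i \<in> A) \<and> (\<forall>i j. i < j \<and> j \<le> \<alpha> \<longrightarrow> d (a i) (a j) > ennreal \<epsilon>))"

definition eps_finite :: "('a \<Rightarrow> 'a \<Rightarrow> ennreal) \<Rightarrow> real \<Rightarrow> 'a set \<Rightarrow> bool" where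
  "eps_finite d \<epsilon> A \<longleftrightarrow> (\<exists>n::nat. eps_card_finite d \<epsilon> (enat n) A)"

definition eps_bounded :: "('a \<Rightarrow> 'a \<Rightarrow> ennreal) \<Rightarrow> real \<Rightarrow> 'a set \<Rightarrow> bool" where
  "eps_bounded d \<epsilon> A \<longleftrightarrow> eps_card_finite d \<epsilon> \<infinity> A"

datatype CB_kind = CB_f | CB_b

fun eps_small :: "CB_kind \<Rightarrow> ('a \<Rightarrow> 'a \<Rightarrow> ennreal) \<Rightarrow> real \<Rightarrow> 'a set \<Rightarrow> bool" where
  "eps_small CB_f d \<epsilon> A = eps_finite d \<epsilon> A"
| "eps_small CB_b d \<epsilon> A = eps_bounded d \<epsilon> A"

definition CB_deriv :: "CB_kind \<Rightarrow> 'a topology \<Rightarrow> ('a \<Rightarrow> 'a \<Rightarrow> ennreal) \<Rightarrow> real \<Rightarrow> 'a set" where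
  "CB_deriv k X d \<epsilon> = topspace X - \<Union>{U. openin X U \<and> eps_small k d \<epsilon> U}"

text \<open>
  The transfinite sequence of derivatives. The second branch covers zero and limit ordinals;
  see the characteristic equations \<open>CB_seq_zero\<close>, \<open>CB_seq_osuc\<close> and \<open>CB_seq_limit\<close>.
\<close>

function CB_seq ::
  "CB_kind \<Rightarrow> 'a topology \<Rightarrow> ('a \<Rightarrow> 'a \<Rightarrow> ennreal) \<Rightarrow> real \<Rightarrow> 'i ordinal \<Rightarrow> 'a set" where
  "CB_seq k X d \<epsilon> \<alpha> =
     (if \<exists>\<beta>. \<alpha> = osuc \<beta>
      then CB_deriv k (subtopology X (CB_seq k X d \<epsilon> (THE \<beta>. \<alpha> = osuc \<beta>))) d \<epsilon>
      else topspace X \<inter> (\<Inter>\<beta>\<in>{..<\<alpha>}. CB_seq k X d \<epsilon> \<beta>))"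
  by pat_completeness auto
termination
proof (relation "inv_image {(\<alpha>, \<beta>). \<alpha> < \<beta>} (\<lambda>(k, X, d, \<epsilon>, \<alpha>). \<alpha>)")
  show "wf (inv_image {(\<alpha>, \<beta>). \<alpha> < \<beta>} (\<lambda>(k :: CB_kind, X :: 'a topology, d :: 'a \<Rightarrow> 'a \<Rightarrow> ennreal, \<epsilon> :: real, \<alpha> :: 'i ordinal). \<alpha>))"
    by (rule wf_inv_image) (rule wf)
qed (auto simp: osuc_inject less_osuc)

declare CB_seq.simps [simp del]

lemma CB_seq_zero:
  assumes "\<And>\<beta>. (\<alpha> :: 'i ordinal) \<le> \<beta>"
  shows "CB_seq k X d \<epsilon> \<alpha> = topspace X"
proof -
  have "{..<\<alpha>} = {}" and "\<nexists>\<beta>. \<alpha> = osuc \<beta>"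
    using assms less_osuc by (auto simp: not_less[symmetric])
  then show ?thesis by (subst CB_seq.simps) simp
qed

lemma CB_seq_osuc: "CB_seq k X d \<epsilon> (osuc \<alpha>) = CB_deriv k (subtopology X (CB_seq k X d \<epsilon> \<alpha>)) d \<epsilon>"
  by (subst CB_seq.simps) (simp add: osuc_inject)

lemma CB_seq_subset_topspace: "CB_seq k X d \<epsilon> \<alpha> \<subseteq> topspace X"
  by (subst CB_seq.simps) (auto simp: CB_deriv_def)

lemma CB_seq_limit: "limit_ordinal \<delta> \<Longrightarrow> CB_seq k X d \<epsilon> \<delta> = (\<Inter>\<beta>\<in>{..<\<delta>}. CB_seq k X d \<epsilon> \<beta>)"
  using CB_seq_subset_topspace[of k X d \<epsilon>]
  by (subst CB_seq.simps) (fastforce simp: limit_ordinal_def)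

lemma CB_seq_osuc_subset: "CB_seq k X d \<epsilon> (osuc \<alpha>) \<subseteq> CB_seq k X d \<epsilon> \<alpha>"
  by (auto simp: CB_seq_osuc CB_deriv_def)

lemma CB_seq_antimono: "\<alpha> \<le> \<beta> \<Longrightarrow> CB_seq k X d \<epsilon> \<beta> \<subseteq> CB_seq k X d \<epsilon> \<alpha>"
proof (induction \<beta> rule: less_induct)
  case (less \<beta>)
  show ?case
  proof (cases "\<alpha> = \<beta>")
    case False
    then have "\<alpha> < \<beta>" using less.prems by simp
    show ?thesis
    proof (cases "\<exists>\<gamma>. \<beta> = osuc \<gamma>")
      case True
      then obtain \<gamma> where \<gamma>: "\<beta> = osuc \<gamma>" ..
      then have "\<alpha> \<le> \<gamma>" "\<gamma> < \<beta>"
        using \<open>\<alpha> < \<beta>\<close> less_osuc osuc_le_iff by (metis not_less)+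
      then show ?thesis
        using less.IH[of \<gamma>] CB_seq_osuc_subset[of k X d \<epsilon> \<gamma>] \<gamma> by auto
    next
      case False
      then have "limit_ordinal \<beta>" using \<open>\<alpha> < \<beta>\<close> by (auto simp: limit_ordinal_def)
      then show ?thesis using \<open>\<alpha> < \<beta>\<close> by (auto simp: CB_seq_limit)
    qed
  qed simp
qed

lemma CB_seq_stabilises:
  fixes X :: "'a topology" and g :: "'a \<Rightarrow> 'i"
  assumes "inj g"
  shows "\<exists>\<alpha> :: 'i ordinal. \<forall>\<beta>\<ge>\<alpha>. CB_seq k X d \<epsilon> \<beta> = CB_seq k X d \<epsilon> \<alpha>"
proof -
  let ?S = "CB_seq k X d \<epsilon> :: 'i ordinal \<Rightarrow> 'a set"
  have "\<exists>\<alpha>. ?S (osuc \<alpha>) = ?S \<alpha>"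
  proof (rule ccontr)
    assume "\<nexists>\<alpha>. ?S (osuc \<alpha>) = ?S \<alpha>"
    then have "\<forall>\<alpha>. \<exists>x. x \<in> ?S \<alpha> - ?S (osuc \<alpha>)"
      using CB_seq_osuc_subset[of k X d \<epsilon>] by blast
    then obtain h where h: "\<And>\<alpha>. h \<alpha> \<in> ?S \<alpha> - ?S (osuc \<alpha>)" by metis
    have "h \<alpha> \<noteq> h \<beta>" if "\<alpha> < \<beta>" for \<alpha> \<beta>
      using h[of \<alpha>] h[of \<beta>] CB_seq_antimono[of "osuc \<alpha>" \<beta> k X d \<epsilon>] that
      by (auto simp: osuc_le_iff)
    then have "inj h" by (metis injI linorder_neqE)
    then have "inj (Inl \<circ> g \<circ> h :: 'i ordinal \<Rightarrow> 'i + nat)"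
      using \<open>inj g\<close> by (auto simp: inj_on_def)
    then show False using ordinal_not_inj by blast
  qed
  then obtain \<alpha> where \<alpha>: "?S (osuc \<alpha>) = ?S \<alpha>" ..
  have "?S \<beta> = ?S \<alpha>" if "\<alpha> \<le> \<beta>" for \<beta>
    using that
  proof (induction \<beta> rule: less_induct)
    case (less \<beta>)
    show ?case
    proof (cases "\<exists>\<gamma>. \<beta> = osuc \<gamma>")
      case True
      then obtain \<gamma> where \<gamma>: "\<beta> = osuc \<gamma>" ..
      show ?thesis
      proof (cases "\<alpha> = \<beta>")
        case False
        then have "\<alpha> \<le> \<gamma>" "\<gamma> < \<beta>"
          using less.prems \<gamma> less_osuc osuc_le_iff by (metis not_less order_le_less)+
        then have "?S \<gamma> = ?S \<alpha>" using less.IH by blast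
        then show ?thesis using \<alpha> \<gamma> by (simp add: CB_seq_osuc)
      qed simp
    next
      case False
      show ?thesis
      proof (cases "\<alpha> = \<beta>")
        case ne: False
        then have lt: "\<alpha> < \<beta>" using less.prems by simp
        then have "limit_ordinal \<beta>" using False by (auto simp: limit_ordinal_def)
        moreover have "?S \<alpha> \<subseteq> ?S \<gamma>" if "\<gamma> < \<beta>" for \<gamma>
          using that less.IH[of \<gamma>] CB_seq_antimono[of \<gamma> \<alpha> k X d \<epsilon>]
          by (cases "\<gamma> \<le> \<alpha>") auto
        ultimately show ?thesis
          using lt CB_seq_antimono[of \<alpha> \<beta> k X d \<epsilon>] by (auto simp: CB_seq_limit)
      qed simp
    qed
  qed
  then show ?thesis by blast
qed

datatype 'i CB_value = Ord "'i ordinal" | CB_Infinity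

definition ord_Sup :: "'i ordinal set \<Rightarrow> 'i ordinal" where
  "ord_Sup S = (LEAST \<beta>. \<forall>\<alpha>\<in>S. \<alpha> \<le> \<beta>)"

text \<open>
  In the second branch the set is bounded, since \<open>CB_seq\<close> is decreasing. The type \<open>'i\<close> must be
  large enough for the points of \<open>X\<close> to inject into it, in the sense of \<open>CB_seq_stabilises\<close>;
  it is not fixed to be \<open>'a\<close> so that ranks in different spaces can be compared.
\<close>

definition CB :: "CB_kind \<Rightarrow> 'a topology \<Rightarrow> ('a \<Rightarrow> 'a \<Rightarrow> ennreal) \<Rightarrow> real \<Rightarrow> 'a set \<Rightarrow> 'i CB_value" where
  "CB k X d \<epsilon> A =
     (if \<forall>\<alpha> :: 'i ordinal. CB_seq k X d \<epsilon> \<alpha> \<inter> A \<noteq> {} then CB_Infinity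
      else Ord (ord_Sup {\<alpha>. CB_seq k X d \<epsilon> \<alpha> \<inter> A \<noteq> {}}))"

fun degree_small :: "CB_kind \<Rightarrow> ('a \<Rightarrow> 'a \<Rightarrow> ennreal) \<Rightarrow> real \<Rightarrow> nat \<Rightarrow> 'a set \<Rightarrow> bool" where
  "degree_small CB_f d \<epsilon> n U = eps_card_finite d \<epsilon> (enat n) U"
| "degree_small CB_b d \<epsilon> n U = (eps_bounded d \<epsilon> U \<and> eps_card_finite d (2 * \<epsilon>) (enat n) U)"

text \<open>
  Meaningful only for compact \<open>K\<close> whose rank is an ordinal. The first argument only says
  in which type of ordinals the rank is taken.
\<close>

definition CBd ::
  "'i itself \<Rightarrow> CB_kind \<Rightarrow> 'a topology \<Rightarrow> ('a \<Rightarrow> 'a \<Rightarrow> ennreal) \<Rightarrow> real \<Rightarrow> 'a set \<Rightarrow> nat" where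
  "CBd _ k X d \<epsilon> K =
     (LEAST n. \<exists>\<alpha> :: 'i ordinal. CB k X d \<epsilon> K = Ord \<alpha> \<and>
        (\<exists>U. openin (subtopology X (CB_seq k X d \<epsilon> \<alpha>)) U \<and> CB_seq k X d \<epsilon> \<alpha> \<inter> K \<subseteq> U \<and>
             degree_small k d \<epsilon> n U))"

end

theory Submission
  imports Defs
begin

text \<open>
  Write \<open>p\<close> for the projection. The preimages of the derivatives of \<open>Y\<close> need not be the derivatives of \<open>X\<close>, since the rank may
  drop at some points of a fibre. What does hold is
  \<open>p ` CB_seq k X dX \<epsilon> \<alpha> = CB_seq k Y dY \<epsilon> \<alpha>\<close> for every ordinal \<open>\<alpha>\<close>: each fibre attains the rank of its
  base point, and does not exceed it. Hence \<open>K\<close> meets a derivative of \<open>Y\<close> iff \<open>p\<inverse>(K)\<close> meets the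
  corresponding derivative of \<open>X\<close>, which is the equality of ranks.

  Two transfer principles for smallness carry the induction. Let \<open>A\<close> be a closed subset of \<open>X\<close>
  that isometric automorphisms map into itself, let \<open>B = p ` A\<close>, and let \<open>W\<close> be open in \<open>Y\<close>.

  \<^item> A precise map does not increase distances, so any lift to \<open>A \<inter> p\<inverse>(W)\<close> of a separated
    family in \<open>B \<inter> W\<close> is separated: if \<open>A \<inter> p\<inverse>(W)\<close> is small then so is \<open>B \<inter> W\<close>
    (\<open>eps_card_finite_image\<close>).
  \<^item> By homogeneity, for a compact \<open>C \<subseteq> W\<close>, a separated family in \<open>A \<inter> p\<inverse>(C)\<close> (which is
    countable) can be moved by an automorphism so that \<open>p\<close> preserves its distances and maps it into
    \<open>B \<inter> W\<close>: if \<open>B \<inter> W\<close> is small then so is \<open>A \<inter> p\<inverse>(C)\<close>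
    (\<open>eps_card_finite_preimage\<close>).

  At a successor, the second principle shows that a point of \<open>A\<close> leaves the derivative of \<open>A\<close> whenever
  its image leaves the derivative of \<open>B\<close>. Conversely, if a fibre of \<open>p\<close> in \<open>A\<close> misses the derivative of \<open>A\<close>, finitely many
  small open sets cover it; their union is again small and, \<open>p\<close> being closed, contains
  \<open>A \<inter> p\<inverse>(W)\<close> for some open \<open>W\<close>, so the first principle applies. At a limit, compactness
  of the fibres suffices. The same two principles compare the open sets that define the degrees.
\<close>

section \<open>Small sets\<close>

text \<open>
  Only the number of points of a separated set matters, not its enumeration, because distinct indices
  yield distinct points. This makes unions easy to handle.
\<close>

lemma eps_card_finite_iff_inj:
  assumes sym: "\<forall>x\<in>A. \<forall>y\<in>A. d x y = d y x" and zero: "\<forall>x\<in>A. d x x = 0"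
  shows "eps_card_finite d \<epsilon> \<alpha> A \<longleftrightarrow>
    \<not> (\<exists>a. inj_on a {..\<alpha>} \<and> a ` {..\<alpha>} \<subseteq> A \<and> pairwise (\<lambda>x y. d x y > ennreal \<epsilon>) (a ` {..\<alpha>}))"
proof -
  have "(\<forall>i\<le>\<alpha>. a i \<in> A) \<and> (\<forall>i j. i < j \<and> j \<le> \<alpha> \<longrightarrow> d (a i) (a j) > ennreal \<epsilon>) \<longleftrightarrow>
      inj_on a {..\<alpha>} \<and> a ` {..\<alpha>} \<subseteq> A \<and> pairwise (\<lambda>x y. d x y > ennreal \<epsilon>) (a ` {..\<alpha>})"
    (is "?L \<longleftrightarrow> ?R") for a :: "enat \<Rightarrow> 'a"
  proof
    assume L: ?L
    have sep: "d (a i) (a j) > ennreal \<epsilon>" if "i \<le> \<alpha>" "j \<le> \<alpha>" "i \<noteq> j" for i j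
      using that L sym by (metis linorder_neqE)
    have "inj_on a {..\<alpha>}"
    proof (rule inj_onI, rule ccontr)
      fix i j assume "i \<in> {..\<alpha>}" "j \<in> {..\<alpha>}" "a i = a j" "i \<noteq> j"
      then have "ennreal \<epsilon> < d (a j) (a j)" "a j \<in> A" using sep[of i j] L by auto
      then show False using zero by simp
    qed
    then show ?R using L sep by (auto simp: pairwise_def)
  next
    assume R: ?R
    have "d (a i) (a j) > ennreal \<epsilon>" if "i < j" "j \<le> \<alpha>" for i j
    proof -
      have "a i \<noteq> a j" using R that by (metis atMost_iff inj_onD less_imp_le less_le_trans less_irrefl)
      then show ?thesis using R that unfolding pairwise_def by auto
    qed
    then show ?L using R by auto
  qed
  then show ?thesis unfolding eps_card_finite_def by blast
qed

lemma eps_card_finite_enat_iff: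
  assumes "\<forall>x\<in>A. \<forall>y\<in>A. d x y = d y x" and "\<forall>x\<in>A. d x x = 0"
  shows "eps_card_finite d \<epsilon> (enat n) A \<longleftrightarrow>
    (\<forall>S\<subseteq>A. pairwise (\<lambda>x y. d x y > ennreal \<epsilon>) S \<longrightarrow> finite S \<and> card S \<le> n)"
    (is "_ \<longleftrightarrow> (\<forall>S\<subseteq>A. ?sep S \<longrightarrow> _)")
proof -
  have "{..enat n} = enat ` {..n}"
  proof -
    have "x \<in> enat ` {..n}" if "x \<le> enat n" for x using that by (cases x) auto
    then show ?thesis by auto
  qed
  then have card: "finite {..enat n}" "card {..enat n} = Suc n" by (simp_all add: card_image inj_on_def)
  have iff: "(\<exists>a. inj_on a {..enat n} \<and> a ` {..enat n} \<subseteq> A \<and> ?sep (a ` {..enat n})) \<longleftrightarrow>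
      (\<exists>S\<subseteq>A. ?sep S \<and> \<not> (finite S \<and> card S \<le> n))" (is "?L \<longleftrightarrow> ?R")
  proof
    assume ?L
    then obtain a where a: "inj_on a {..enat n}" "a ` {..enat n} \<subseteq> A" "?sep (a ` {..enat n})" by blast
    then have "card (a ` {..enat n}) = Suc n" using card by (simp add: card_image)
    then show ?R using a by (intro exI[of _ "a ` {..enat n}"]) auto
  next
    assume ?R
    then obtain S where S: "S \<subseteq> A" "?sep S" "\<not> (finite S \<and> card S \<le> n)" by blast
    have "\<exists>T\<subseteq>S. finite T \<and> card T = Suc n"
      using S(3) obtain_subset_with_card_n[of "Suc n" S] infinite_arbitrarily_large[of S "Suc n"]
      by (metis not_less_eq_eq)
    then obtain T where T: "T \<subseteq> S" "finite T" "card T = Suc n" by blast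
    then obtain a where "bij_betw a {..enat n} T"
      using card finite_same_card_bij[of "{..enat n}" T] by auto
    then have "inj_on a {..enat n}" "a ` {..enat n} = T" by (auto simp: bij_betw_def)
    moreover have "?sep T" using S(2) T(1) by (rule pairwise_subset)
    ultimately show ?L using S(1) T(1) by blast
  qed
  show ?thesis
    unfolding eps_card_finite_iff_inj[OF assms] iff by blast
qed

lemma eps_bounded_iff:
  assumes "\<forall>x\<in>A. \<forall>y\<in>A. d x y = d y x" and "\<forall>x\<in>A. d x x = 0"
  shows "eps_bounded d \<epsilon> A \<longleftrightarrow>
    (\<forall>S\<subseteq>A. pairwise (\<lambda>x y. d x y > ennreal \<epsilon>) S \<longrightarrow> finite S)"
    (is "_ \<longleftrightarrow> (\<forall>S\<subseteq>A. ?sep S \<longrightarrow> _)")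
proof -
  have univ: "{..\<infinity>} = (UNIV :: enat set)" by auto
  have iff: "(\<exists>a. inj_on a {..\<infinity>::enat} \<and> a ` {..\<infinity>} \<subseteq> A \<and> ?sep (a ` {..\<infinity>})) \<longleftrightarrow>
      (\<exists>S\<subseteq>A. ?sep S \<and> infinite S)" (is "?L \<longleftrightarrow> ?R")
  proof
    assume ?L
    then obtain a where a: "inj_on a {..\<infinity>::enat}" "a ` {..\<infinity>} \<subseteq> A" "?sep (a ` {..\<infinity>})" by blast
    have "infinite (UNIV :: enat set)"
      using finite_imageD[of enat UNIV] finite_subset[of "range enat" UNIV] by (auto simp: inj_on_def)
    then have "infinite (a ` {..\<infinity>})" using a(1) by (simp add: univ finite_image_iff)
    then show ?R using a(2,3) by blast
  next
    assume ?R
    then obtain S where S: "S \<subseteq> A" "?sep S" "infinite S" by blast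
    then obtain f :: "nat \<Rightarrow> 'a" where f: "inj f" "range f \<subseteq> S"
      using infinite_countable_subset by blast
    define a where "a i = (case i of enat n \<Rightarrow> f (Suc n) | \<infinity> \<Rightarrow> f 0)" for i
    have "inj a" using f(1) by (auto simp: inj_def a_def split: enat.splits)
    moreover have "range a \<subseteq> S" using f(2) by (auto simp: a_def split: enat.splits)
    moreover from this have "?sep (range a)" using S(2) pairwise_subset by blast
    ultimately show ?L using S(1) unfolding univ by blast
  qed
  show ?thesis
    unfolding eps_bounded_def eps_card_finite_iff_inj[OF assms] iff by blast
qed

lemma eps_small_Un:
  assumes sym: "\<forall>x\<in>A \<union> B. \<forall>y\<in>A \<union> B. d x y = d y x" and zero: "\<forall>x\<in>A \<union> B. d x x = 0"
    and A: "eps_small k d \<epsilon> A" and B: "eps_small k d \<epsilon> B"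
  shows "eps_small k d \<epsilon> (A \<union> B)"
proof -
  have symA: "\<forall>x\<in>A. \<forall>y\<in>A. d x y = d y x" using sym by blast
  have symB: "\<forall>x\<in>B. \<forall>y\<in>B. d x y = d y x" using sym by blast
  have zeroA: "\<forall>x\<in>A. d x x = 0" using zero by blast
  have zeroB: "\<forall>x\<in>B. d x x = 0" using zero by blast
  show ?thesis
  proof (cases k)
    case CB_f
    then obtain m n where mn: "eps_card_finite d \<epsilon> (enat m) A" "eps_card_finite d \<epsilon> (enat n) B"
      using A B by (auto simp: eps_finite_def)
    have "finite S \<and> card S \<le> m + n"
      if S: "S \<subseteq> A \<union> B" "pairwise (\<lambda>x y. d x y > ennreal \<epsilon>) S" for S
    proof -
      have sep: "pairwise (\<lambda>x y. d x y > ennreal \<epsilon>) T" if "T \<subseteq> S" for T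
        using S(2) that by (rule pairwise_subset)
      have "finite (S \<inter> A) \<and> card (S \<inter> A) \<le> m"
        using mn(1) sep[of "S \<inter> A"] unfolding eps_card_finite_enat_iff[OF symA zeroA] by blast
      moreover have "finite (S \<inter> B) \<and> card (S \<inter> B) \<le> n"
        using mn(2) sep[of "S \<inter> B"] unfolding eps_card_finite_enat_iff[OF symB zeroB] by blast
      moreover have "S = (S \<inter> A) \<union> (S \<inter> B)" using S(1) by auto
      ultimately show ?thesis
        using card_Un_le[of "S \<inter> A" "S \<inter> B"] by (metis add_mono finite_UnI order_trans)
    qed
    then have "eps_card_finite d \<epsilon> (enat (m + n)) (A \<union> B)"
      unfolding eps_card_finite_enat_iff[OF sym zero] by blast
    then show ?thesis using CB_f by (auto simp: eps_finite_def)
  next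
    case CB_b
    then have bd: "eps_bounded d \<epsilon> A" "eps_bounded d \<epsilon> B" using A B by auto
    have "finite S"
      if S: "S \<subseteq> A \<union> B" "pairwise (\<lambda>x y. d x y > ennreal \<epsilon>) S" for S
    proof -
      have sep: "pairwise (\<lambda>x y. d x y > ennreal \<epsilon>) T" if "T \<subseteq> S" for T
        using S(2) that by (rule pairwise_subset)
      have "finite (S \<inter> A)"
        using bd(1) sep[of "S \<inter> A"] unfolding eps_bounded_iff[OF symA zeroA] by blast
      moreover have "finite (S \<inter> B)"
        using bd(2) sep[of "S \<inter> B"] unfolding eps_bounded_iff[OF symB zeroB] by blast
      moreover have "S = (S \<inter> A) \<union> (S \<inter> B)" using S(1) by auto
      ultimately show ?thesis by (metis finite_UnI)
    qed
    then have "eps_bounded d \<epsilon> (A \<union> B)"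
      unfolding eps_bounded_iff[OF sym zero] by blast
    then show ?thesis using CB_b by simp
  qed
qed

lemma eps_small_empty: "eps_small k d \<epsilon> {}"
  by (cases k) (auto simp: eps_finite_def eps_bounded_def eps_card_finite_def)

lemma eps_small_Union:
  assumes sym: "\<forall>x\<in>T. \<forall>y\<in>T. d x y = d y x" and zero: "\<forall>x\<in>T. d x x = 0"
    and "finite \<F>" and "\<And>A. A \<in> \<F> \<Longrightarrow> A \<subseteq> T \<and> eps_small k d \<epsilon> A"
  shows "eps_small k d \<epsilon> (\<Union>\<F>)"
  using assms(3,4)
proof (induction \<F>)
  case empty
  then show ?case by (simp add: eps_small_empty)
next
  case (insert A \<F>)
  have sub: "A \<union> \<Union>\<F> \<subseteq> T" using insert.prems by auto
  have "eps_small k d \<epsilon> (A \<union> \<Union>\<F>)"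
  proof (rule eps_small_Un)
    show "\<forall>x\<in>A \<union> \<Union>\<F>. \<forall>y\<in>A \<union> \<Union>\<F>. d x y = d y x" using sym sub by blast
    show "\<forall>x\<in>A \<union> \<Union>\<F>. d x x = 0" using zero sub by blast
  qed (use insert in auto)
  then show ?case by simp
qed

text \<open>
  All notions of smallness in use are combinations of \<open>eps_card_finite\<close> for various separation
  constants and indices, so they pass from one set to another as soon as \<open>eps_card_finite\<close> does.
\<close>

lemma eps_small_transfer:
  assumes "\<And>\<epsilon> \<alpha>. eps_card_finite d \<epsilon> \<alpha> A \<Longrightarrow> eps_card_finite d' \<epsilon> \<alpha> B" and "eps_small k d \<epsilon> A"
  shows "eps_small k d' \<epsilon> B"
  using assms by (cases k) (auto simp: eps_finite_def eps_bounded_def)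

lemma degree_small_transfer:
  assumes "\<And>\<epsilon> \<alpha>. eps_card_finite d \<epsilon> \<alpha> A \<Longrightarrow> eps_card_finite d' \<epsilon> \<alpha> B" and "degree_small k d \<epsilon> n A"
  shows "degree_small k d' \<epsilon> n B"
  using assms by (cases k) (auto simp: eps_bounded_def)

lemma eps_card_finite_mono:
  "A \<subseteq> B \<Longrightarrow> eps_card_finite d \<epsilon> \<alpha> B \<Longrightarrow> eps_card_finite d \<epsilon> \<alpha> A"
  unfolding eps_card_finite_def by blast

lemma eps_small_mono: "A \<subseteq> B \<Longrightarrow> eps_small k d \<epsilon> B \<Longrightarrow> eps_small k d \<epsilon> A"
  by (rule eps_small_transfer) (rule eps_card_finite_mono)

section \<open>Derivatives\<close>

lemma mem_CB_seq_osuc_iff: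
  "x \<in> CB_seq k X d \<epsilon> (osuc \<alpha>) \<longleftrightarrow>
     x \<in> CB_seq k X d \<epsilon> \<alpha> \<and>
     (\<forall>U. openin X U \<longrightarrow> x \<in> U \<longrightarrow> \<not> eps_small k d \<epsilon> (CB_seq k X d \<epsilon> \<alpha> \<inter> U))"
  using CB_seq_subset_topspace[of k X d \<epsilon> \<alpha>]
  by (auto simp: CB_seq_osuc CB_deriv_def openin_subtopology Int_commute)

lemma CB_seq_not_osuc:
  "\<nexists>\<beta>. \<alpha> = osuc \<beta> \<Longrightarrow> CB_seq k X d \<epsilon> \<alpha> = topspace X \<inter> (\<Inter>\<beta>\<in>{..<\<alpha>}. CB_seq k X d \<epsilon> \<beta>)"
  by (subst CB_seq.simps) simp

lemma closedin_CB_seq: "closedin X (CB_seq k X d \<epsilon> \<alpha>)"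
proof (induction \<alpha> rule: less_induct)
  case (less \<alpha>)
  show ?case
  proof (cases "\<exists>\<beta>. \<alpha> = osuc \<beta>")
    case True
    then obtain \<beta> where \<beta>: "\<alpha> = osuc \<beta>" ..
    let ?Z = "subtopology X (CB_seq k X d \<epsilon> \<beta>)"
    have "closedin ?Z (CB_seq k X d \<epsilon> \<alpha>)"
      unfolding \<beta> CB_seq_osuc CB_deriv_def by (intro closedin_diff closedin_topspace openin_Union) auto
    then show ?thesis
      using less.IH[of \<beta>] less_osuc[of \<beta>] \<beta> closedin_trans_full by blast
  next
    case False
    have "topspace X \<inter> (\<Inter>\<beta>\<in>{..<\<alpha>}. CB_seq k X d \<epsilon> \<beta>) =
        \<Inter> (insert (topspace X) (CB_seq k X d \<epsilon> ` {..<\<alpha>}))" by simp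
    moreover have "closedin X (\<Inter> (insert (topspace X) (CB_seq k X d \<epsilon> ` {..<\<alpha>})))"
      using less.IH by (intro closedin_Inter) auto
    ultimately show ?thesis using CB_seq_not_osuc[OF False, of k X d \<epsilon>] by simp
  qed
qed

text \<open>
  Pulling a small neighbourhood of \<open>f x\<close> back along the automorphism \<open>f\<close> gives a small neighbourhood of \<open>x\<close>.
\<close>

lemma isometric_automorphism_CB_seq:
  assumes f: "isometric_automorphism X d f" and x: "x \<in> CB_seq k X d \<epsilon> \<alpha>"
  shows "f x \<in> CB_seq k X d \<epsilon> \<alpha>"
  using x
proof (induction \<alpha> arbitrary: x rule: less_induct)
  case (less \<alpha>)
  have hom: "homeomorphic_map X X f"
    and iso: "\<And>x y. x \<in> topspace X \<Longrightarrow> y \<in> topspace X \<Longrightarrow> d (f x) (f y) = d x y"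
    using f by (auto simp: isometric_automorphism_def)
  then have cont: "continuous_map X X f" by (simp add: homeomorphic_imp_continuous_map)
  have xX: "x \<in> topspace X" using less.prems CB_seq_subset_topspace[of k X d \<epsilon> \<alpha>] by blast
  show ?case
  proof (cases "\<exists>\<beta>. \<alpha> = osuc \<beta>")
    case True
    then obtain \<beta> where \<beta>: "\<alpha> = osuc \<beta>" ..
    let ?A = "CB_seq k X d \<epsilon> \<beta>"
    have IH: "f z \<in> ?A" if "z \<in> ?A" for z using less.IH[of \<beta> z] \<beta> less_osuc that by blast
    have A: "?A \<subseteq> topspace X" by (rule CB_seq_subset_topspace)
    have "\<not> eps_small k d \<epsilon> (?A \<inter> U)" if U: "openin X U" "f x \<in> U" for U
    proof
      assume small: "eps_small k d \<epsilon> (?A \<inter> U)"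
      let ?V = "{z \<in> topspace X. f z \<in> U}"
      have "eps_card_finite d e n (?A \<inter> ?V)" if "eps_card_finite d e n (?A \<inter> U)" for e n
        unfolding eps_card_finite_def
      proof
        assume "\<exists>a. (\<forall>i\<le>n. a i \<in> ?A \<inter> ?V) \<and> (\<forall>i j. i < j \<and> j \<le> n \<longrightarrow> d (a i) (a j) > ennreal e)"
        then obtain a where a: "\<And>i. i \<le> n \<Longrightarrow> a i \<in> ?A \<inter> ?V"
          "\<And>i j. i < j \<and> j \<le> n \<Longrightarrow> d (a i) (a j) > ennreal e" by blast
        have "d (f (a i)) (f (a j)) > ennreal e" if "i < j \<and> j \<le> n" for i j
          using a(1)[of i] a(1)[of j] a(2)[OF that] that iso[of "a i" "a j"] by auto
        moreover have "\<forall>i\<le>n. f (a i) \<in> ?A \<inter> U" using a(1) IH by auto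
        ultimately show False
          using that unfolding eps_card_finite_def by (auto dest!: spec[of _ "f \<circ> a"])
      qed
      then have "eps_small k d \<epsilon> (?A \<inter> ?V)" using small by (rule eps_small_transfer)
      moreover have "openin X ?V" using cont U(1) by (rule openin_continuous_map_preimage)
      ultimately show False using less.prems xX U(2) unfolding \<beta> mem_CB_seq_osuc_iff by blast
    qed
    then show ?thesis using less.prems IH unfolding \<beta> mem_CB_seq_osuc_iff by blast
  next
    case False
    have "f x \<in> topspace X" using cont xX by (auto simp: continuous_map_def)
    then show ?thesis using less False by (auto simp: CB_seq_not_osuc[OF False])
  qed
qed

lemma topometric_space_imp_Hausdorff:
  assumes "topometric_space X d"
  shows "Hausdorff_space X"
proof -
  have "{(a, b). a \<in> topspace X \<and> b \<in> topspace X \<and> d a b \<le> ennreal 0} = (\<lambda>x. (x, x)) ` topspace X"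
    using assms unfolding topometric_space_def by auto
  moreover have "closedin (prod_topology X X)
      {(a, b). a \<in> topspace X \<and> b \<in> topspace X \<and> d a b \<le> ennreal 0}"
    using assms unfolding topometric_space_def by blast
  ultimately show ?thesis by (simp add: Hausdorff_space_closedin_diagonal)
qed

section \<open>Homogeneous extensions\<close>

locale homogeneous_extension =
  fixes X :: "'x topology" and dX :: "'x \<Rightarrow> 'x \<Rightarrow> ennreal"
    and Y :: "'y topology" and dY :: "'y \<Rightarrow> 'y \<Rightarrow> ennreal"
    and p :: "'x \<Rightarrow> 'y"
  assumes X: "topometric_space X dX" "compact_space X"
    and Y: "topometric_space Y dY" "compact_space Y"
    and cont: "continuous_map X Y p" and surj: "p ` topspace X = topspace Y"
    and precise: "precise_map X dX Y dY p"
    and homogeneous: "homogeneous_over X dX Y dY p"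
begin

lemma p_in: "x \<in> topspace X \<Longrightarrow> p x \<in> topspace Y"
  using surj by auto

lemma Hausdorff_Y: "Hausdorff_space Y"
  using Y(1) by (rule topometric_space_imp_Hausdorff)

lemma closed_map_p: "closed_map X Y p"
  using cont X(2) Hausdorff_Y by (rule continuous_imp_closed_map)

text \<open>The point \<open>y\<close> belongs to the fibre over \<open>p y\<close>, whose distance to \<open>x\<close> preciseness equates with
  \<open>dY (p x) (p y)\<close>.\<close>

lemma p_nonexpansive:
  assumes "x \<in> topspace X" "y \<in> topspace X"
  shows "dY (p x) (p y) \<le> dX x y"
proof -
  have "dY (p x) (p y) = set_distance dX x (preimage X p {p y})"
    using precise assms p_in by (auto simp: precise_map_def)
  also have "\<dots> \<le> dX x y"
    unfolding set_distance_def preimage_def using assms by (intro INF_lower) auto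
  finally show ?thesis .
qed

lemma shrink_open:
  assumes "closedin Y C" "openin Y W" "C \<subseteq> W"
  obtains V where "openin Y V" "C \<subseteq> V" "compactin Y (Y closure_of V)" "Y closure_of V \<subseteq> W"
proof -
  have "normal_space Y"
    using Y(2) Hausdorff_Y compact_Hausdorff_or_regular_imp_normal_space by blast
  then obtain V where V: "openin Y V" "C \<subseteq> V" "Y closure_of V \<subseteq> W"
    using assms normal_space_alt[of Y] by metis
  moreover have "compactin Y (Y closure_of V)"
    using Y(2) by (rule closedin_compact_space) (rule closedin_closure_of)
  ultimately show ?thesis using that by blast
qed

lemma eps_card_finite_image:
  assumes A: "A \<subseteq> topspace X" and fin: "eps_card_finite dX \<epsilon> \<alpha> (A \<inter> preimage X p W)"
  shows "eps_card_finite dY \<epsilon> \<alpha> (p ` A \<inter> W)"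
  unfolding eps_card_finite_def
proof
  assume "\<exists>b. (\<forall>i\<le>\<alpha>. b i \<in> p ` A \<inter> W) \<and> (\<forall>i j. i < j \<and> j \<le> \<alpha> \<longrightarrow> dY (b i) (b j) > ennreal \<epsilon>)"
  then obtain b where b: "\<And>i. i \<le> \<alpha> \<Longrightarrow> b i \<in> p ` A \<inter> W"
    "\<And>i j. i < j \<and> j \<le> \<alpha> \<Longrightarrow> dY (b i) (b j) > ennreal \<epsilon>" by blast
  have "\<forall>i. \<exists>x. i \<le> \<alpha> \<longrightarrow> x \<in> A \<and> p x = b i" using b(1) by (metis IntD1 imageE)
  then obtain a where a: "\<And>i. i \<le> \<alpha> \<Longrightarrow> a i \<in> A \<and> p (a i) = b i" by metis
  have "dX (a i) (a j) > ennreal \<epsilon>" if "i < j \<and> j \<le> \<alpha>" for i j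
    using b(2)[OF that] p_nonexpansive[of "a i" "a j"] a[of i] a[of j] A that
    by (auto simp: subset_iff)
  moreover have "\<forall>i\<le>\<alpha>. a i \<in> A \<inter> preimage X p W"
    using a b(1) A by (force simp: preimage_def)
  ultimately show False using fin unfolding eps_card_finite_def by blast
qed

lemma eps_card_finite_preimage:
  assumes A: "A \<subseteq> topspace X" and inv: "\<forall>f x. isometric_automorphism X dX f \<longrightarrow> x \<in> A \<longrightarrow> f x \<in> A"
    and C: "compactin Y C" "openin Y W" "C \<subseteq> W"
    and fin: "eps_card_finite dY \<epsilon> \<alpha> (p ` A \<inter> W)"
  shows "eps_card_finite dX \<epsilon> \<alpha> (A \<inter> preimage X p C)"
  unfolding eps_card_finite_def
proof
  assume "\<exists>a. (\<forall>i\<le>\<alpha>. a i \<in> A \<inter> preimage X p C) \<and>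
    (\<forall>i j. i < j \<and> j \<le> \<alpha> \<longrightarrow> dX (a i) (a j) > ennreal \<epsilon>)"
  then obtain a where a: "\<And>i. i \<le> \<alpha> \<Longrightarrow> a i \<in> A \<inter> preimage X p C"
    "\<And>i j. i < j \<and> j \<le> \<alpha> \<Longrightarrow> dX (a i) (a j) > ennreal \<epsilon>" by blast
  have "countable (a ` {..\<alpha>})" by simp
  moreover have "a ` {..\<alpha>} \<subseteq> preimage X p C" using a(1) by auto
  ultimately obtain f where f: "isometric_automorphism X dX f"
    "\<forall>x\<in>a ` {..\<alpha>}. \<forall>y\<in>a ` {..\<alpha>}. dY (p (f x)) (p (f y)) = dX x y"
    "\<forall>x\<in>a ` {..\<alpha>}. p (f x) \<in> W"
    using homogeneous C unfolding homogeneous_over_def by meson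
  define b where "b i = p (f (a i))" for i
  have "\<forall>i\<le>\<alpha>. b i \<in> p ` A \<inter> W" using a(1) f(1,3) inv by (auto simp: b_def)
  moreover have "dY (b i) (b j) > ennreal \<epsilon>" if "i < j \<and> j \<le> \<alpha>" for i j
    using a(2)[OF that] f(2) that by (auto simp: b_def)
  ultimately show False using fin unfolding eps_card_finite_def by blast
qed

text \<open>A tube lemma: since \<open>p\<close> is closed, the part of \<open>A\<close> outside \<open>U\<close> has a closed image, which misses \<open>K\<close>.\<close>

lemma tube:
  assumes A: "closedin X A" and U: "openin X U" and K: "K \<subseteq> topspace Y" and AU: "A \<inter> preimage X p K \<subseteq> U"
  obtains W where "openin Y W" "K \<subseteq> W" "A \<inter> preimage X p W \<subseteq> U"
proof
  let ?W = "topspace Y - p ` (A - U)"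
  have "closedin X (A - U)" using A U by (rule closedin_diff)
  then show "openin Y ?W" using closed_map_p by (auto simp: closed_map_def)
  show "K \<subseteq> ?W" using K AU closedin_subset[OF A] by (auto simp: preimage_def)
  show "A \<inter> preimage X p ?W \<subseteq> U" by (auto simp: preimage_def)
qed

lemma image_CB_seq: "p ` CB_seq k X dX \<epsilon> \<alpha> = CB_seq k Y dY \<epsilon> \<alpha>"
proof (induction \<alpha> rule: less_induct)
  case (less \<alpha>)
  have fibre_closed: "closedin X (preimage X p {y})" if "y \<in> topspace Y" for y
    unfolding preimage_def using cont Hausdorff_Y that
    by (intro closedin_continuous_map_preimage[of X Y]) (auto intro: closedin_Hausdorff_singleton)
  show ?case
  proof (cases "\<exists>\<beta>. \<alpha> = osuc \<beta>")
    case True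
    then obtain \<beta> where \<beta>: "\<alpha> = osuc \<beta>" ..
    let ?A = "CB_seq k X dX \<epsilon> \<beta>" and ?B = "CB_seq k Y dY \<epsilon> \<beta>"
    have AB: "p ` ?A = ?B" using less.IH \<beta> less_osuc by blast
    have A: "?A \<subseteq> topspace X" by (rule CB_seq_subset_topspace)
    have inv: "\<forall>f x. isometric_automorphism X dX f \<longrightarrow> x \<in> ?A \<longrightarrow> f x \<in> ?A"
      by (intro allI impI) (rule isometric_automorphism_CB_seq)
    show ?thesis
    proof (intro equalityI subsetI)
      fix y assume "y \<in> p ` CB_seq k X dX \<epsilon> \<alpha>"
      then obtain x where x: "x \<in> CB_seq k X dX \<epsilon> (osuc \<beta>)" and y: "y = p x" using \<beta> by blast
      have xA: "x \<in> ?A" using x by (simp add: mem_CB_seq_osuc_iff)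
      then have yY: "y \<in> topspace Y" using A p_in y by auto
      have "\<not> eps_small k dY \<epsilon> (?B \<inter> W)" if W: "openin Y W" "y \<in> W" for W
      proof
        assume small: "eps_small k dY \<epsilon> (?B \<inter> W)"
        obtain V where V: "openin Y V" "{y} \<subseteq> V" "compactin Y (Y closure_of V)" "Y closure_of V \<subseteq> W"
          using shrink_open[of "{y}" W] W yY closedin_Hausdorff_singleton[OF Hausdorff_Y] by auto
        have "eps_small k dX \<epsilon> (?A \<inter> preimage X p (Y closure_of V))"
          using _ small[folded AB]
          by (rule eps_small_transfer)
            (rule eps_card_finite_preimage[OF A inv V(3) W(1) V(4)])
        moreover have "?A \<inter> preimage X p V \<subseteq> ?A \<inter> preimage X p (Y closure_of V)"
          using closure_of_subset[OF openin_subset[OF V(1)]] by (auto simp: preimage_def)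
        ultimately have "eps_small k dX \<epsilon> (?A \<inter> preimage X p V)" by (rule eps_small_mono[rotated])
        moreover have "openin X (preimage X p V)"
          unfolding preimage_def using cont V(1) by (rule openin_continuous_map_preimage)
        moreover have "x \<in> preimage X p V" using V(2) xA A y by (auto simp: preimage_def)
        ultimately show False using x by (auto simp: mem_CB_seq_osuc_iff)
      qed
      then show "y \<in> CB_seq k Y dY \<epsilon> \<alpha>"
        using xA y AB by (auto simp: \<beta> mem_CB_seq_osuc_iff)
    next
      fix y assume "y \<in> CB_seq k Y dY \<epsilon> \<alpha>"
      then have y: "y \<in> ?B" and large: "\<And>W. openin Y W \<Longrightarrow> y \<in> W \<Longrightarrow> \<not> eps_small k dY \<epsilon> (?B \<inter> W)"
        by (auto simp: \<beta> mem_CB_seq_osuc_iff)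
      have yY: "y \<in> topspace Y" by (rule subsetD[OF CB_seq_subset_topspace y])
      show "y \<in> p ` CB_seq k X dX \<epsilon> \<alpha>"
      proof (rule ccontr)
        assume no: "y \<notin> p ` CB_seq k X dX \<epsilon> \<alpha>"
        let ?F = "?A \<inter> preimage X p {y}"
        let ?\<U> = "{U. openin X U \<and> eps_small k dX \<epsilon> (?A \<inter> U)}"
        have "?F \<subseteq> \<Union>?\<U>"
        proof
          fix x assume x: "x \<in> ?F"
          then have "x \<notin> CB_seq k X dX \<epsilon> (osuc \<beta>)" using no by (auto simp: \<beta> preimage_def)
          then show "x \<in> \<Union>?\<U>" using x unfolding mem_CB_seq_osuc_iff by blast
        qed
        moreover have "compactin X ?F"
          using X(2) fibre_closed[OF yY] closedin_CB_seq closedin_compact_space by blast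
        ultimately obtain \<F> where \<F>: "finite \<F>" "\<F> \<subseteq> ?\<U>" "?F \<subseteq> \<Union>\<F>"
          using compactinD[of X ?F ?\<U>] by auto
        have "openin X (\<Union>\<F>)" using \<F>(2) by auto
        then obtain W where W: "openin Y W" "y \<in> W" "?A \<inter> preimage X p W \<subseteq> \<Union>\<F>"
          using tube[OF closedin_CB_seq _ _ \<F>(3)] yY by auto
        have "eps_small k dX \<epsilon> (\<Union> ((\<inter>) ?A ` \<F>))"
          using X(1) \<F>(1,2) A
          by (intro eps_small_Union[where T = "topspace X"]) (auto simp: topometric_space_def)
        moreover have "?A \<inter> preimage X p W \<subseteq> \<Union> ((\<inter>) ?A ` \<F>)" using W(3) by auto
        ultimately have "eps_small k dX \<epsilon> (?A \<inter> preimage X p W)" by (rule eps_small_mono[rotated])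
        with eps_card_finite_image[OF A, of _ _ W] have "eps_small k dY \<epsilon> (p ` ?A \<inter> W)"
          by (rule eps_small_transfer)
        then show False using large W(1,2) AB by simp
      qed
    qed
  next
    case False
    show ?thesis
    proof (intro equalityI subsetI)
      fix y assume "y \<in> p ` CB_seq k X dX \<epsilon> \<alpha>"
      then show "y \<in> CB_seq k Y dY \<epsilon> \<alpha>"
        using p_in by (auto simp: CB_seq_not_osuc[OF False] less.IH[symmetric])
    next
      fix y assume y: "y \<in> CB_seq k Y dY \<epsilon> \<alpha>"
      have yY: "y \<in> topspace Y" by (rule subsetD[OF CB_seq_subset_topspace y])
      let ?F = "preimage X p {y}" and ?S = "CB_seq k X dX \<epsilon>"
      \<comment> \<open>The fibre itself is a member of the family because \<open>{..<\<alpha>}\<close> is empty when \<open>\<alpha>\<close> is zero.\<close>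
      let ?\<C> = "insert ?F ((\<lambda>\<beta>. ?S \<beta> \<inter> ?F) ` {..<\<alpha>})"
      have ne: "?S \<beta> \<inter> ?F \<noteq> {}" if "\<beta> < \<alpha>" for \<beta>
      proof -
        have "y \<in> p ` ?S \<beta>" using y less.IH that by (auto simp: CB_seq_not_osuc[OF False])
        then show ?thesis using CB_seq_subset_topspace[of k X dX \<epsilon> \<beta>] by (auto simp: preimage_def)
      qed
      have ne0: "?F \<noteq> {}" using yY by (auto simp: preimage_def surj[symmetric])
      have fip: "\<Inter>\<F> \<noteq> {}" if fin: "finite \<F>" "\<F> \<subseteq> ?\<C>" for \<F>
      proof -
        have "finite (\<F> - {?F})" "\<F> - {?F} \<subseteq> (\<lambda>\<beta>. ?S \<beta> \<inter> ?F) ` {..<\<alpha>}" using fin by auto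
        from finite_subset_image[OF this] obtain I where I: "I \<subseteq> {..<\<alpha>}" "finite I"
          "\<F> - {?F} = (\<lambda>\<beta>. ?S \<beta> \<inter> ?F) ` I"
          by blast
        show ?thesis
        proof (cases "I = {}")
          case True
          then have "\<F> \<subseteq> {?F}" using I(3) by auto
          then show ?thesis using ne0 by (auto simp: subset_singleton_iff)
        next
          case I_ne: False
          \<comment> \<open>The derivatives decrease, so the one of largest index lies in all the others.\<close>
          have "?S (Max I) \<inter> ?F \<subseteq> C" if "C \<in> \<F>" for C
          proof (cases "C = ?F")
            case False
            then have "C \<in> (\<lambda>\<beta>. ?S \<beta> \<inter> ?F) ` I" unfolding I(3)[symmetric] using that by simp
            then obtain \<beta> where \<beta>: "\<beta> \<in> I" "C = ?S \<beta> \<inter> ?F" by (rule imageE)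
            have "?S (Max I) \<subseteq> ?S \<beta>" using I(2) \<beta>(1) by (intro CB_seq_antimono Max_ge)
            then show ?thesis unfolding \<beta>(2) by (intro Int_mono subset_refl)
          qed (simp only: Int_lower2)
          moreover have "Max I < \<alpha>" using I(1,2) I_ne Max_in by blast
          ultimately show ?thesis using ne[of "Max I"] by blast
        qed
      qed
      have "\<forall>C\<in>?\<C>. closedin X C"
        using fibre_closed[OF yY] by (auto intro: closedin_CB_seq)
      moreover have "\<forall>\<F>. finite \<F> \<and> \<F> \<subseteq> ?\<C> \<longrightarrow> \<Inter>\<F> \<noteq> {}"
        by (intro allI impI, elim conjE) (rule fip)
      ultimately have "(\<forall>C\<in>?\<C>. closedin X C) \<and> (\<forall>\<F>. finite \<F> \<and> \<F> \<subseteq> ?\<C> \<longrightarrow> \<Inter>\<F> \<noteq> {})"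
        by (rule conjI)
      with X(2)[unfolded compact_space_fip, THEN spec] have "\<Inter>?\<C> \<noteq> {}" by (rule mp)
      then obtain x where "x \<in> ?F" "\<forall>\<beta><\<alpha>. x \<in> ?S \<beta>" by blast
      then show "y \<in> p ` ?S \<alpha>"
        by (auto simp: CB_seq_not_osuc[OF False] preimage_def image_iff)
    qed
  qed
qed

lemma CB_seq_meets_iff:
  "CB_seq k Y dY \<epsilon> \<alpha> \<inter> K \<noteq> {} \<longleftrightarrow> CB_seq k X dX \<epsilon> \<alpha> \<inter> preimage X p K \<noteq> {}"
  using CB_seq_subset_topspace[of k X dX \<epsilon> \<alpha>]
  unfolding image_CB_seq[symmetric] by (auto simp: preimage_def)

lemma CB_eq: "(CB k Y dY \<epsilon> K :: 'i CB_value) = CB k X dX \<epsilon> (preimage X p K)"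
  unfolding CB_def by (simp only: CB_seq_meets_iff)

text \<open>
  Towards \<open>X\<close>, homogeneity only controls preimages of compact sets, so the witness is first shrunk around
  the compact set \<open>B \<inter> K\<close>; towards \<open>Y\<close>, the witness is obtained from the tube lemma.
\<close>

lemma degree_witness_iff:
  fixes \<alpha> :: "'i ordinal" and k :: CB_kind and \<epsilon> :: real
  assumes K: "compactin Y K"
  defines "A \<equiv> CB_seq k X dX \<epsilon> \<alpha>" and "B \<equiv> CB_seq k Y dY \<epsilon> \<alpha>"
  shows "(\<exists>V. openin (subtopology Y B) V \<and> B \<inter> K \<subseteq> V \<and> degree_small k dY \<epsilon> n V) \<longleftrightarrow>
    (\<exists>U. openin (subtopology X A) U \<and> A \<inter> preimage X p K \<subseteq> U \<and> degree_small k dX \<epsilon> n U)"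
proof -
  have A: "A \<subseteq> topspace X" "closedin X A"
    unfolding A_def by (rule CB_seq_subset_topspace closedin_CB_seq)+
  have inv: "\<forall>f x. isometric_automorphism X dX f \<longrightarrow> x \<in> A \<longrightarrow> f x \<in> A"
    unfolding A_def by (intro allI impI) (rule isometric_automorphism_CB_seq)
  have AB: "p ` A = B" unfolding A_def B_def by (rule image_CB_seq)
  show ?thesis
  proof
    assume "\<exists>V. openin (subtopology Y B) V \<and> B \<inter> K \<subseteq> V \<and> degree_small k dY \<epsilon> n V"
    then obtain W where W: "openin Y W" "B \<inter> K \<subseteq> W" and small: "degree_small k dY \<epsilon> n (B \<inter> W)"
      by (auto simp: openin_subtopology Int_commute)
    have "closedin Y (B \<inter> K)"
      unfolding B_def using K closedin_CB_seq compactin_imp_closedin[OF Hausdorff_Y] by blast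
    then obtain V where V: "openin Y V" "B \<inter> K \<subseteq> V" "compactin Y (Y closure_of V)"
      "Y closure_of V \<subseteq> W"
      using shrink_open W by blast
    have "eps_card_finite dX e m (A \<inter> preimage X p V)"
      if "eps_card_finite dY e m (p ` A \<inter> W)" for e m
    proof (rule eps_card_finite_mono)
      show "A \<inter> preimage X p V \<subseteq> A \<inter> preimage X p (Y closure_of V)"
        using closure_of_subset[OF openin_subset[OF V(1)]] by (auto simp: preimage_def)
      show "eps_card_finite dX e m (A \<inter> preimage X p (Y closure_of V))"
        using A(1) inv V(3) W(1) V(4) that by (rule eps_card_finite_preimage)
    qed
    then have "degree_small k dX \<epsilon> n (A \<inter> preimage X p V)"
      using small[folded AB] by (rule degree_small_transfer)
    moreover have "openin X (preimage X p V)"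
      unfolding preimage_def using cont V(1) by (rule openin_continuous_map_preimage)
    then have "openin (subtopology X A) (A \<inter> preimage X p V)"
      by (rule openin_subtopology_Int2)
    moreover have "A \<inter> preimage X p K \<subseteq> A \<inter> preimage X p V"
      using V(2) AB by (auto simp: preimage_def)
    ultimately show "\<exists>U. openin (subtopology X A) U \<and> A \<inter> preimage X p K \<subseteq> U \<and> degree_small k dX \<epsilon> n U"
      by blast
  next
    assume "\<exists>U. openin (subtopology X A) U \<and> A \<inter> preimage X p K \<subseteq> U \<and> degree_small k dX \<epsilon> n U"
    then obtain U where U: "openin X U" "A \<inter> preimage X p K \<subseteq> U" and small: "degree_small k dX \<epsilon> n (A \<inter> U)"
      by (auto simp: openin_subtopology Int_commute)
    obtain W where W: "openin Y W" "K \<subseteq> W" "A \<inter> preimage X p W \<subseteq> U"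
      using tube[OF A(2) U(1) compactin_subset_topspace[OF K] U(2)] by blast
    have "eps_card_finite dY e m (B \<inter> W)" if "eps_card_finite dX e m (A \<inter> U)" for e m
      using eps_card_finite_image[OF A(1) eps_card_finite_mono[OF _ that]] W(3) AB by auto
    then have "degree_small k dY \<epsilon> n (B \<inter> W)" using small by (rule degree_small_transfer)
    moreover have "openin (subtopology Y B) (B \<inter> W)"
      using W(1) by (rule openin_subtopology_Int2)
    ultimately show "\<exists>V. openin (subtopology Y B) V \<and> B \<inter> K \<subseteq> V \<and> degree_small k dY \<epsilon> n V"
      using W(2) by blast
  qed
qed

lemma CBd_eq:
  assumes "compactin Y K"
  shows "CBd TYPE('i) k Y dY \<epsilon> K = CBd TYPE('i) k X dX \<epsilon> (preimage X p K)"
  unfolding CBd_def CB_eq degree_witness_iff[OF assms] by (rule refl)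

end

theorem theorem3p30:
  fixes X :: "'x topology" and dX :: "'x \<Rightarrow> 'x \<Rightarrow> ennreal"
    and Y :: "'y topology" and dY :: "'y \<Rightarrow> 'y \<Rightarrow> ennreal"
    and \<pi> :: "'x \<Rightarrow> 'y"
  assumes "topometric_space X dX" and "compact_space X"
    and "topometric_space Y dY" and "compact_space Y"
    and "continuous_map X Y \<pi>" and "\<pi> ` topspace X = topspace Y"
    and "precise_map X dX Y dY \<pi>"
    and "homogeneous_over X dX Y dY \<pi>"
  shows "\<forall>K k. \<forall>\<epsilon>::real. K \<subseteq> topspace Y \<longrightarrow> \<epsilon> > 0 \<longrightarrow>
           (CB k Y dY \<epsilon> K :: ('x + 'y) CB_value) = CB k X dX \<epsilon> (preimage X \<pi> K) \<and>
           ((\<exists>\<alpha>. (CB k Y dY \<epsilon> K :: ('x + 'y) CB_value) = Ord \<alpha>) \<and> compactin Y K \<longrightarrow>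
             CBd TYPE('x + 'y) k Y dY \<epsilon> K = CBd TYPE('x + 'y) k X dX \<epsilon> (preimage X \<pi> K))"
proof -
  interpret homogeneous_extension X dX Y dY \<pi>
    using assms by unfold_locales
  show ?thesis by (intro allI impI conjI CB_eq CBd_eq) blast
qed

end
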